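(* Let $A$ and $B$ be two densely defined closable operators in a complex Hilbert space $H$ such that $\sigma(AB)\neq\mathbb{C}$ and $\sigma(BA)\neq\mathbb{C}$. If $\ker(A^* )=\ker(A)$ and $\ker(B)=\ker(B^* )$, then $\sigma(BA)=\sigma(AB)$.
   Context: All operators are linear and possibly unbounded. Products carry their natural domains: $D(AB)=\{x\in D(B):Bx\in D(A)\}$. The resolvent set of an operator $A$ (not assumed closed) is $\rho(A)=\{\lambda\in\mathbb{C}:\lambda I-A \text{ is bijective from } D(A) \text{ onto } H \text{ and } (\lambda I-A)^{-1}\in B(H)\}$, where $B(H)$ is the set of bounded everywhere defined operators, and $\sigma(A)=\mathbb{C}\setminus\rho(A)$; thus $\sigma(A)=\mathbb{C}$ when $A$ is not closed. *)

theory Defs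
  imports "HOL-Analysis.Analysis"
begin

text \<open>
  Complex inner product spaces, with the inner product linear in its first argument. The norm,
  and hence the topology of \<^class>\<open>real_normed_vector\<close>, is the one induced by it.
\<close>

class complex_inner = real_normed_vector +
  fixes scaleC :: "complex \<Rightarrow> 'a \<Rightarrow> 'a"  (infixr "*\<^sub>C" 75)
    and cinner :: "'a \<Rightarrow> 'a \<Rightarrow> complex"
  assumes scaleC_add_right: "c *\<^sub>C (x + y) = c *\<^sub>C x + c *\<^sub>C y"
    and scaleC_add_left: "(c + d) *\<^sub>C x = c *\<^sub>C x + d *\<^sub>C x"
    and scaleC_scaleC: "c *\<^sub>C (d *\<^sub>C x) = (c * d) *\<^sub>C x"
    and scaleC_of_real: "complex_of_real r *\<^sub>C x = r *\<^sub>R x"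
    and cinner_commute: "cinner x y = cnj (cinner y x)"
    and cinner_add_left: "cinner (x + y) z = cinner x z + cinner y z"
    and cinner_scaleC_left: "cinner (c *\<^sub>C x) y = c * cinner x y"
    and cinner_ge_zero: "0 \<le> Re (cinner x x)"
    and cinner_eq_zero_iff: "cinner x x = 0 \<longleftrightarrow> x = 0"
    and norm_eq_sqrt_cinner: "norm x = sqrt (Re (cinner x x))"

class complex_hilbert = complex_inner + complete_space

text \<open>
  A possibly unbounded operator is a partial function \<open>A :: 'a \<rightharpoonup> 'a\<close> with domain \<^term>\<open>dom A\<close>.
  The composition \<^term>\<open>A \<circ>\<^sub>m B\<close> of the library then has the natural domain of a product.
\<close>

definition linear_operator :: "('a::complex_inner \<rightharpoonup> 'a) \<Rightarrow> bool" where
  "linear_operator A \<longleftrightarrow>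
     A 0 = Some 0 \<and>
     (\<forall>x y u v. A x = Some u \<and> A y = Some v \<longrightarrow> A (x + y) = Some (u + v)) \<and>
     (\<forall>c x u. A x = Some u \<longrightarrow> A (c *\<^sub>C x) = Some (c *\<^sub>C u))"

definition densely_defined :: "('a::complex_inner \<rightharpoonup> 'a) \<Rightarrow> bool" where
  "densely_defined A \<longleftrightarrow> closure (dom A) = UNIV"

definition closed_operator :: "('a::complex_inner \<rightharpoonup> 'a) \<Rightarrow> bool" where
  "closed_operator A \<longleftrightarrow> linear_operator A \<and> closed (Map.graph A)"

definition closable_operator :: "('a::complex_inner \<rightharpoonup> 'a) \<Rightarrow> bool" where
  "closable_operator A \<longleftrightarrow> linear_operator A \<and> (\<exists>C. closed_operator C \<and> A \<subseteq>\<^sub>m C)"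

text \<open>
  The vector \<open>z\<close> below is unique when \<open>A\<close> is densely defined; for other operators the values of
  \<open>adjoint_operator A\<close> are meaningless.
\<close>

definition adjoint_operator :: "('a::complex_inner \<rightharpoonup> 'a) \<Rightarrow> ('a \<rightharpoonup> 'a)" where
  "adjoint_operator A = (\<lambda>y.
     if \<exists>z. \<forall>x\<in>dom A. cinner (the (A x)) y = cinner x z
     then Some (THE z. \<forall>x\<in>dom A. cinner (the (A x)) y = cinner x z)
     else None)"

definition operator_kernel :: "('a::complex_inner \<rightharpoonup> 'a) \<Rightarrow> 'a set" where
  "operator_kernel A = {x \<in> dom A. A x = Some 0}"

definition bounded_operators :: "('a::complex_inner \<Rightarrow> 'a) set" where
  "bounded_operators = {T. bounded_linear T \<and> (\<forall>c x. T (c *\<^sub>C x) = c *\<^sub>C T x)}"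

text \<open>The operator \<open>l I - A\<close>, with the domain of \<open>A\<close>.\<close>

definition shifted_operator :: "complex \<Rightarrow> ('a::complex_inner \<rightharpoonup> 'a) \<Rightarrow> ('a \<rightharpoonup> 'a)" where
  "shifted_operator l A = (\<lambda>x. map_option (\<lambda>u. l *\<^sub>C x - u) (A x))"

definition resolvent_set :: "('a::complex_inner \<rightharpoonup> 'a) \<Rightarrow> complex set" where
  "resolvent_set A = {l.
     bij_betw (the \<circ> shifted_operator l A) (dom A) UNIV \<and>
     inv_into (dom A) (the \<circ> shifted_operator l A) \<in> bounded_operators}"

definition spectrum :: "('a::complex_inner \<rightharpoonup> 'a) \<Rightarrow> complex set" where
  "spectrum A = UNIV - resolvent_set A"

end

theory Submission
  imports Defs
begin

text \<open>
  If \<open>\<mu> \<in> \<rho>(BA)\<close>, then \<open>BA\<close> is closed, so by the closed graph theorem \<open>\<lambda> \<in> \<rho>(BA)\<close> as soon as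
  \<open>\<lambda>I - BA\<close> is bijective. Let \<open>\<lambda> \<in> \<rho>(AB)\<close>. To solve \<open>(\<lambda>I - BA)x = y\<close> for all \<open>y\<close> it suffices to solve
  it for \<open>y \<in> D(A)\<close>, because \<open>(\<mu>I - BA)\<^sup>-\<^sup>1\<close> maps into \<open>D(A)\<close>. If \<open>\<lambda> \<noteq> 0\<close>, then
  \<open>x = \<lambda>\<^sup>-\<^sup>1(y + B(\<lambda>I - AB)\<^sup>-\<^sup>1Ay)\<close> is the solution for such \<open>y\<close>. If \<open>\<lambda> = 0\<close>, then \<open>A\<close> is surjective, so
  \<open>ker(A) = ker(A\<^sup>*) = 0\<close>, and the injectivity of \<open>A\<close> transfers the bijectivity of \<open>AB\<close> to \<open>BA\<close>.
\<close>

subsection \<open>The closed graph theorem\<close>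

text \<open>Baire category: in a complete space, countably many closed sets with empty interior have
  a union with empty interior, which cannot be the whole space.\<close>

lemma closed_cover_interior_nonempty:
  fixes E :: "nat \<Rightarrow> 'a::banach set"
  assumes closed: "\<And>n. closed (E n)" and cover: "(\<Union>n. E n) = UNIV"
  obtains n where "interior (E n) \<noteq> {}"
proof -
  have "\<exists>n. interior (E n) \<noteq> {}"
  proof (rule ccontr)
    assume "\<not> ?thesis"
    then have "Met_TC.mtopology interior_of \<Union>(range E) = {}"
      using closed by (intro Met_TC.metric_Baire_category_alt) (auto simp: complete_UNIV)
    then show False
      using cover by simp
  qed
  then show thesis
    using that by blast
qed

text \<open>No continuity of \<open>f\<close> is assumed. The sets where
  \<open>norm (f x) \<le> n\<close> cover the space, so by Baire the closure of one of them contains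
  a ball. Rescaled differences of elements of that set approximate every vector with relative error
  1/2, with \<open>f\<close> under control.\<close>

lemma linear_approximate_preimage:
  fixes f :: "'a::banach \<Rightarrow> 'b::real_normed_vector"
  assumes "linear f"
  obtains K where "K \<ge> 0" "\<And>x. \<exists>u. norm (x - u) \<le> norm x / 2 \<and> norm (f u) \<le> K * norm x"
proof -
  interpret linear f by fact
  define E where "E n = closure {x. norm (f x) \<le> real n}" for n
  have "x \<in> (\<Union>n. E n)" for x
  proof -
    obtain n where "norm (f x) \<le> real n"
      using real_arch_simple by blast
    then have "x \<in> E n"
      unfolding E_def by (intro closure_subset[THEN subsetD]) simp
    then show ?thesis by blast
  qed
  then obtain n where "interior (E n) \<noteq> {}"
    using closed_cover_interior_nonempty[of E] unfolding E_def by blast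
  then obtain x0 r where r: "r > 0" "ball x0 r \<subseteq> E n"
    by (metis all_not_in_conv mem_interior)
  have close: "\<exists>a. norm (z - a) < r / 8 \<and> norm (f a) \<le> n" if "norm (z - x0) < r" for z
  proof -
    have "z \<in> E n"
      using that r(2) by (auto simp: dist_norm norm_minus_commute)
    then show ?thesis
      using r(1) unfolding E_def closure_approachable
      by (metis (no_types, lifting) dist_norm divide_pos_pos mem_Collect_eq norm_minus_commute
          zero_less_numeral)
  qed
  show thesis
  proof (rule that)
    show "4 * real n / r \<ge> 0" using r by simp
    fix x
    show "\<exists>u. norm (x - u) \<le> norm x / 2 \<and> norm (f u) \<le> 4 * real n / r * norm x"
    proof (cases "x = 0")
      case True
      then show ?thesis by (intro exI[of _ 0]) simp
    next
      case False
      \<comment> \<open>The scaling gives \<open>t *\<^sub>R x\<close> length \<open>r / 2\<close>,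
        so \<open>x0 + t *\<^sub>R x\<close> stays in the ball. Two errors below
        \<open>r / 8\<close> add up to at most half of that length, and \<open>2 * n / t\<close> is
        the claimed bound \<open>4 * n / r * norm x\<close>.\<close>
      define t where "t = r / (2 * norm x)"
      have t: "t > 0" "norm (t *\<^sub>R x) = r / 2"
        using False r by (auto simp: t_def)
      obtain a where a: "norm (x0 + t *\<^sub>R x - a) < r / 8" "norm (f a) \<le> n"
        using close[of "x0 + t *\<^sub>R x"] t r by auto
      obtain b where b: "norm (x0 - b) < r / 8" "norm (f b) \<le> n"
        using close[of x0] r by auto
      define u where "u = (1 / t) *\<^sub>R (a - b)"
      have "norm (t *\<^sub>R x - (a - b)) \<le> norm (x0 + t *\<^sub>R x - a) + norm (x0 - b)"
        by (rule order_trans[OF _ norm_triangle_ineq4]) (simp add: algebra_simps)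
      also have "\<dots> \<le> r / 4"
        using a b by simp
      finally have "norm (t *\<^sub>R x - (a - b)) / t \<le> r / 4 / t"
        using t by (intro divide_right_mono) auto
      moreover have "x - u = (1 / t) *\<^sub>R (t *\<^sub>R x - (a - b))"
        using t by (simp add: u_def algebra_simps)
      then have "norm (x - u) = norm (t *\<^sub>R x - (a - b)) / t"
        using t by simp
      moreover have "r / 4 / t = norm x / 2"
        using r by (simp add: t_def)
      ultimately have "norm (x - u) \<le> norm x / 2"
        by simp
      moreover have "norm (f (a - b)) \<le> 2 * n"
        using norm_triangle_ineq4[of "f a" "f b"] a b by (simp add: diff)
      then have "norm (f (a - b)) / t \<le> 2 * n / t"
        using t by (intro divide_right_mono) auto
      then have "norm (f u) \<le> 2 * n / t"
        using t by (simp add: u_def scale)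
      then have "norm (f u) \<le> 4 * real n / r * norm x"
        using r by (simp add: t_def field_simps)
      ultimately show ?thesis by blast
    qed
  qed
qed

text \<open>Repeated approximation writes \<open>x\<close> as a series whose images under
  \<open>f\<close> are dominated by a geometric series. Closedness of the graph identifies the sum
  of the images with \<open>f x\<close>.\<close>

theorem closed_graph_bounded_linear:
  fixes f :: "'a::banach \<Rightarrow> 'b::banach"
  assumes "linear f" and graph: "closed (range (\<lambda>x. (x, f x)))"
  shows "bounded_linear f"
proof -
  interpret linear f by fact
  obtain K where K: "K \<ge> 0" "\<And>x. \<exists>u. norm (x - u) \<le> norm x / 2 \<and> norm (f u) \<le> K * norm x"
    using linear_approximate_preimage[OF \<open>linear f\<close>] by blast
  then obtain u where u: "\<And>x. norm (x - u x) \<le> norm x / 2" "\<And>x. norm (f (u x)) \<le> K * norm x"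
    by metis
  have "norm (f x) \<le> norm x * (2 * K)" for x
  proof -
    \<comment> \<open>\<open>s k\<close> is the remainder after \<open>k\<close> approximations. Its
      norm at least halves each time, and the sums of the \<open>u (s k)\<close> telescope.\<close>
    define s where "s k = ((\<lambda>x. x - u x) ^^ k) x" for k
    have s_Suc: "s (Suc k) = s k - u (s k)" and s_0: "s 0 = x" for k
      by (simp_all add: s_def)
    have norm_s: "norm (s k) \<le> norm x * (1/2) ^ k" for k
    proof (induction k)
      case (Suc k)
      then show ?case using u(1)[of "s k"] by (simp add: s_Suc)
    qed (simp add: s_0)
    have norm_fu: "norm (f (u (s k))) \<le> K * norm x * (1/2) ^ k" for k
      using order_trans[OF u(2)[of "s k"] mult_left_mono[OF norm_s[of k] K(1)]]
      by (simp add: mult.assoc)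
    have geometric: "(\<lambda>k. K * norm x * (1/2) ^ k) sums (K * norm x * 2)"
      using geometric_sums[of "1/2::real"] by (intro sums_mult) simp
    have summable: "summable (\<lambda>k. f (u (s k)))"
      by (rule summable_comparison_test'[OF sums_summable[OF geometric]]) (rule norm_fu)
    have sum_u: "(\<Sum>k<n. u (s k)) = x - s n" for n
      by (induction n) (simp_all add: s_0 s_Suc)
    have "s \<longlonglongrightarrow> 0"
    proof (rule Lim_null_comparison)
      show "(\<lambda>k. norm x * (1/2) ^ k) \<longlonglongrightarrow> 0"
        by (intro tendsto_mult_right_zero LIMSEQ_power_zero) simp
    qed (simp add: norm_s)
    then have "(\<lambda>n. \<Sum>k<n. u (s k)) \<longlonglongrightarrow> x"
      unfolding sum_u by (auto intro: tendsto_eq_intros)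
    moreover have "(\<lambda>n. f (\<Sum>k<n. u (s k))) \<longlonglongrightarrow> (\<Sum>k. f (u (s k)))"
      unfolding sum using summable by (rule summable_LIMSEQ)
    ultimately have "(x, \<Sum>k. f (u (s k))) \<in> range (\<lambda>x. (x, f x))"
      using closed_sequentially[OF graph, of "\<lambda>n. (\<Sum>k<n. u (s k), f (\<Sum>k<n. u (s k)))"]
      by (simp add: tendsto_Pair)
    then have "norm (f x) = norm (\<Sum>k. f (u (s k)))"
      by auto
    also have "\<dots> \<le> (\<Sum>k. K * norm x * (1/2) ^ k)"
      by (rule norm_suminf_le[OF norm_fu sums_summable[OF geometric]])
    finally show ?thesis
      using sums_unique[OF geometric] by (simp add: mult_ac)
  qed
  then show ?thesis
    by (intro bounded_linear_intro[of _ "2 * K"]) (auto simp: add scale)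
qed

subsection \<open>Resolvents of partial operators\<close>

instance complex_hilbert \<subseteq> banach ..

text \<open>The unit law is not a class axiom; it comes from the compatibility with real
  scaling.\<close>

interpretation scaleC: vector_space "scaleC :: complex \<Rightarrow> 'a \<Rightarrow> 'a::complex_inner"
proof
  show "1 *\<^sub>C x = x" for x :: 'a
    using scaleC_of_real[of 1 x] by simp
qed (auto simp: scaleC_add_right scaleC_add_left scaleC_scaleC)

lemma norm_scaleC: "norm (c *\<^sub>C x) = cmod c * norm (x::'a::complex_inner)"
proof -
  have "cinner (c *\<^sub>C x) (c *\<^sub>C x) = c * cnj c * cinner x x"
    by (metis cinner_commute cinner_scaleC_left complex_cnj_mult mult.assoc)
  then have "Re (cinner (c *\<^sub>C x) (c *\<^sub>C x)) = (cmod c)\<^sup>2 * Re (cinner x x)"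
    by (simp add: complex_norm_square[symmetric] del: of_real_power)
  then show ?thesis
    by (simp add: norm_eq_sqrt_cinner real_sqrt_mult)
qed

lemma tendsto_scaleC:
  fixes f :: "'b \<Rightarrow> 'a::complex_inner"
  assumes "(f \<longlongrightarrow> x) F"
  shows "((\<lambda>t. c *\<^sub>C f t) \<longlongrightarrow> c *\<^sub>C x) F"
proof -
  have "bounded_linear (\<lambda>x::'a. c *\<^sub>C x)"
  proof (rule bounded_linear_intro[where K = "cmod c"])
    show "c *\<^sub>C (r *\<^sub>R x) = r *\<^sub>R (c *\<^sub>C x)" for r and x :: 'a
      by (simp flip: scaleC_of_real add: scaleC_scaleC mult.commute)
  qed (simp_all add: scaleC_add_right norm_scaleC mult.commute)
  then show ?thesis
    using assms by (rule bounded_linear.tendsto)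
qed

lemma linear_operator_zero: "linear_operator A \<Longrightarrow> A 0 = Some 0"
  by (simp add: linear_operator_def)

lemma linear_operator_add:
  "linear_operator A \<Longrightarrow> A x = Some u \<Longrightarrow> A y = Some v \<Longrightarrow> A (x + y) = Some (u + v)"
  by (simp add: linear_operator_def)

lemma linear_operator_scaleC:
  "linear_operator A \<Longrightarrow> A x = Some u \<Longrightarrow> A (c *\<^sub>C x) = Some (c *\<^sub>C u)"
  by (simp add: linear_operator_def)

lemma linear_operator_diff:
  assumes "linear_operator A" "A x = Some u" "A y = Some v"
  shows "A (x - y) = Some (u - v)"
  using linear_operator_add[OF assms(1,2) linear_operator_scaleC[OF assms(1,3), of "-1"]]
  by simp

lemma linear_operator_comp:
  "linear_operator A \<Longrightarrow> linear_operator B \<Longrightarrow> linear_operator (A \<circ>\<^sub>m B)"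
  by (auto simp: linear_operator_def map_comp_Some_iff)

lemma linear_operator_shifted:
  fixes C :: "'a::complex_inner \<rightharpoonup> 'a"
  assumes "linear_operator C"
  shows "linear_operator (shifted_operator l C)"
proof -
  have "l *\<^sub>C (c *\<^sub>C x) - c *\<^sub>C u = c *\<^sub>C (l *\<^sub>C x - u)" for c and x u :: 'a
    by (simp add: scaleC.scale_right_diff_distrib scaleC_scaleC mult.commute)
  then show ?thesis
    using assms by (auto simp: linear_operator_def shifted_operator_def scaleC_add_right)
qed

lemma shifted_operator_eq_Some_iff:
  "shifted_operator l C x = Some y \<longleftrightarrow> C x = Some (l *\<^sub>C x - y)"
  by (auto simp: shifted_operator_def)

text \<open>This removes \<open>the\<close>, so that resolvents can be handled through equations
  \<open>F x = Some y\<close>.\<close>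

lemma bij_betw_the_dom_iff: "bij_betw (the \<circ> F) (dom F) UNIV \<longleftrightarrow> (\<forall>y. \<exists>!x. F x = Some y)"
proof
  assume bij: "bij_betw (the \<circ> F) (dom F) UNIV"
  show "\<forall>y. \<exists>!x. F x = Some y"
  proof
    fix y
    have "\<exists>x\<in>dom F. the (F x) = y"
      using bij by (metis UNIV_I bij_betw_imp_surj_on comp_apply imageE)
    moreover have "x = x'" if "F x = Some y" "F x' = Some y" for x x'
      using bij_betw_imp_inj_on[OF bij, THEN inj_onD, of x x'] that by auto
    ultimately show "\<exists>!x. F x = Some y"
      by auto
  qed
next
  assume ex1: "\<forall>y. \<exists>!x. F x = Some y"
  show "bij_betw (the \<circ> F) (dom F) UNIV"
  proof (rule bij_betw_imageI)
    show "inj_on (the \<circ> F) (dom F)"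
      using ex1 by (auto intro!: inj_onI) metis
    have "y \<in> (the \<circ> F) ` dom F" for y
    proof -
      obtain x where "F x = Some y"
        using ex1 by blast
      then show ?thesis
        by (intro image_eqI[of _ _ x]) auto
    qed
    then show "(the \<circ> F) ` dom F = UNIV"
      by blast
  qed
qed

lemma inv_into_the_dom_eq_iff:
  assumes "\<forall>y. \<exists>!x. F x = Some y"
  shows "inv_into (dom F) (the \<circ> F) y = x \<longleftrightarrow> F x = Some y"
proof -
  have bij: "bij_betw (the \<circ> F) (dom F) UNIV"
    using assms by (simp add: bij_betw_the_dom_iff)
  have "inv_into (dom F) (the \<circ> F) y \<in> dom F" "the (F (inv_into (dom F) (the \<circ> F) y)) = y"
    using bij_betw_imp_surj_on[OF bij] inv_into_into[of y "the \<circ> F" "dom F"]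
      f_inv_into_f[of y "the \<circ> F" "dom F"] by auto
  then have "F (inv_into (dom F) (the \<circ> F) y) = Some y"
    by auto
  then show ?thesis
    using assms by metis
qed

lemma dom_shifted_operator [simp]: "dom (shifted_operator l C) = dom C"
  by (auto simp: shifted_operator_def)

lemma resolvent_set_iff:
  "l \<in> resolvent_set C \<longleftrightarrow> (\<forall>y. \<exists>!x. shifted_operator l C x = Some y) \<and>
     inv_into (dom (shifted_operator l C)) (the \<circ> shifted_operator l C) \<in> bounded_operators"
  using bij_betw_the_dom_iff[of "shifted_operator l C"] by (simp add: resolvent_set_def)

lemma resolvent_set_ex1:
  "l \<in> resolvent_set C \<Longrightarrow> \<exists>!x. C x = Some (l *\<^sub>C x - y)"
  by (simp add: resolvent_set_iff shifted_operator_eq_Some_iff)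

text \<open>The bounded resolvent \<open>S\<close> at \<open>m\<close> makes \<open>C\<close>
  closed. Hence the inverse \<open>T\<close> of the bijective \<open>l I - C\<close> has a closed
  graph, and the closed graph theorem bounds it.\<close>

lemma resolvent_setI:
  fixes C :: "'a::complex_hilbert \<rightharpoonup> 'a"
  assumes lin: "linear_operator C" and m: "m \<in> resolvent_set C"
    and inj: "\<And>x. C x = Some (l *\<^sub>C x) \<Longrightarrow> x = 0"
    and surj: "\<And>y. \<exists>x. C x = Some (l *\<^sub>C x - y)"
  shows "l \<in> resolvent_set C"
proof -
  define S where "S = inv_into (dom (shifted_operator m C)) (the \<circ> shifted_operator m C)"
  define T where "T = inv_into (dom (shifted_operator l C)) (the \<circ> shifted_operator l C)"
  have "x = x'" if "C x = Some (l *\<^sub>C x - y)" "C x' = Some (l *\<^sub>C x' - y)" for x x' y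
    using inj[of "x - x'"] linear_operator_diff[OF lin that]
    by (simp add: scaleC.scale_right_diff_distrib)
  then have ex1: "\<forall>y. \<exists>!x. shifted_operator l C x = Some y"
    using surj unfolding shifted_operator_eq_Some_iff by metis
  have S: "S y = x \<longleftrightarrow> C x = Some (m *\<^sub>C x - y)" for x y
    using m unfolding S_def resolvent_set_iff
    by (simp add: inv_into_the_dom_eq_iff shifted_operator_eq_Some_iff del: dom_shifted_operator)
  have "bounded_linear S"
    using m by (simp add: S_def resolvent_set_iff bounded_operators_def)
  have T_shifted: "T y = x \<longleftrightarrow> shifted_operator l C x = Some y" for x y
    unfolding T_def by (rule inv_into_the_dom_eq_iff[OF ex1])
  then have T: "T y = x \<longleftrightarrow> C x = Some (l *\<^sub>C x - y)" for x y
    by (simp add: shifted_operator_eq_Some_iff)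
  note lin_shifted = linear_operator_shifted[OF lin, of l]
  have T_add: "T (x + y) = T x + T y" for x y
    using T_shifted linear_operator_add[OF lin_shifted] by metis
  have T_scaleC: "T (c *\<^sub>C x) = c *\<^sub>C T x" for c x
    using T_shifted linear_operator_scaleC[OF lin_shifted] by metis
  have "linear T"
    by (rule linearI) (simp_all add: T_add T_scaleC flip: scaleC_of_real)
  moreover have "closed (range (\<lambda>y. (y, T y)))"
    unfolding closed_sequential_limits
  proof (intro allI impI, elim conjE)
    fix X p assume X: "\<forall>n. X n \<in> range (\<lambda>y. (y, T y))" and lim: "X \<longlonglongrightarrow> p"
    obtain y x where p: "p = (y, x)" by fastforce
    define Y where "Y n = fst (X n)" for n
    have snd_X: "snd (X n) = T (Y n)" for n
      using X[rule_format, of n] by (auto simp: Y_def)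
    have Y: "Y \<longlonglongrightarrow> y" and TY: "(\<lambda>n. T (Y n)) \<longlonglongrightarrow> x"
      using tendsto_fst[OF lim] tendsto_snd[OF lim]
      by (simp_all add: p Y_def[abs_def] snd_X[unfolded Y_def])
    \<comment> \<open>Resolvent identity: \<open>x = T y\<close> satisfies
      \<open>(m I - C) x = y + (m - l) x\<close>. The continuity of \<open>S\<close> carries it to
      the limit, where it reads \<open>C x = l x - y\<close>.\<close>
    have "S (Y n + (m - l) *\<^sub>C T (Y n)) = T (Y n)" for n
      using T[of "Y n" "T (Y n)"] by (simp add: S scaleC.scale_left_diff_distrib)
    then have "(\<lambda>n. T (Y n)) \<longlonglongrightarrow> S (y + (m - l) *\<^sub>C x)"
      using bounded_linear.tendsto[OF \<open>bounded_linear S\<close>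
          tendsto_add[OF Y tendsto_scaleC[OF TY]], of "m - l"]
      by simp
    then have "S (y + (m - l) *\<^sub>C x) = x"
      using TY LIMSEQ_unique by blast
    then have "T y = x"
      by (simp add: S T scaleC.scale_left_diff_distrib)
    then show "p \<in> range (\<lambda>y. (y, T y))"
      by (auto simp: p)
  qed
  ultimately have "bounded_linear T"
    by (rule closed_graph_bounded_linear)
  then show ?thesis
    using ex1 T_scaleC by (simp add: resolvent_set_iff bounded_operators_def T_def)
qed

subsection \<open>Comparison of the two products\<close>

text \<open>The kernel of the adjoint is orthogonal to the range of \<open>A\<close>, here the whole
  space.\<close>

lemma kernel_adjoint_subset_zero:
  fixes A :: "'a::complex_inner \<rightharpoonup> 'a"
  assumes dense: "densely_defined A" and surj: "\<And>y. \<exists>x. A x = Some y"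
  shows "operator_kernel (adjoint_operator A) \<subseteq> {0}"
proof
  fix y assume "y \<in> operator_kernel (adjoint_operator A)"
  then have y: "adjoint_operator A y = Some 0"
    by (simp add: operator_kernel_def)
  let ?P = "\<lambda>z. \<forall>x\<in>dom A. cinner (the (A x)) y = cinner x z"
  have "\<exists>z. ?P z" and THE: "(THE z. ?P z) = 0"
    using y by (auto simp: adjoint_operator_def split: if_splits)
  then obtain z where z: "?P z" by blast
  \<comment> \<open>That the \<open>THE\<close> term equals 0 yields \<open>?P 0\<close> only once
    the vector with this property is known to be unique. Two candidates differ by a vector
    orthogonal to the dense domain.\<close>
  have "w = z" if w: "?P w" for w
  proof (rule ccontr)
    assume "w \<noteq> z"
    define d where "d = w - z"
    have add: "cinner x (a + b) = cinner x a + cinner x b" for x a b :: 'a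
      by (metis cinner_add_left cinner_commute complex_cnj_add)
    have orth: "cinner x d = 0" if "x \<in> dom A" for x
      using add[of x z d] w z that by (simp add: d_def)
    have "d \<in> closure (dom A)"
      using dense by (simp add: densely_defined_def)
    moreover have "norm d > 0"
      using \<open>w \<noteq> z\<close> by (simp add: d_def)
    \<comment> \<open>Since \<open>x\<close> is orthogonal to \<open>d\<close>, Pythagoras forces
      \<open>norm (x - d) \<ge> norm d\<close>, a contradiction that needs no continuity of the
      inner product.\<close>
    ultimately obtain x where x: "x \<in> dom A" "norm (x - d) < norm d"
      unfolding closure_approachable dist_norm by blast
    have sq: "(norm v)\<^sup>2 = Re (cinner v v)" for v :: 'a
      by (simp add: norm_eq_sqrt_cinner cinner_ge_zero)
    have "cinner x x = cinner (x - d + d) (x - d + d)"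
      by simp
    also have "\<dots> = cinner (x - d) (x - d) + cinner (x - d + d) d + cinner d (x - d + d) - cinner d d"
      by (simp only: add cinner_add_left) simp
    also have "\<dots> = cinner (x - d) (x - d) - cinner d d"
      using orth[OF x(1)] cinner_commute[of d x] by simp
    finally have "(norm (x - d))\<^sup>2 = (norm x)\<^sup>2 + (norm d)\<^sup>2"
      by (simp add: sq)
    then show False
      using power_strict_mono[OF x(2) norm_ge_zero, of 2] by simp
  qed
  then have "(THE z. ?P z) = z"
    using z by (intro the_equality)
  then have "?P 0"
    using THE z by simp
  moreover obtain x where "A x = Some y"
    using surj by blast
  ultimately have "cinner y y = cinner x 0"
    by force
  also have "\<dots> = 0"
    using cinner_scaleC_left[of 0 0 x] cinner_commute[of x 0] by simp
  finally show "y \<in> {0}"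
    by (simp add: cinner_eq_zero_iff)
qed

text \<open>A single inclusion, to be used again with \<open>A\<close> and \<open>B\<close>
  exchanged. The point \<open>m\<close> from \<open>nonempty\<close> serves both to extend
  solvability beyond the domain of \<open>A\<close> and to obtain boundedness.\<close>

lemma resolvent_set_comp_subset:
  fixes A B :: "'a::complex_hilbert \<rightharpoonup> 'a"
  assumes A: "linear_operator A" and B: "linear_operator B" and dense: "densely_defined A"
    and kernel: "operator_kernel A \<subseteq> operator_kernel (adjoint_operator A)"
    and nonempty: "resolvent_set (B \<circ>\<^sub>m A) \<noteq> {}"
  shows "resolvent_set (A \<circ>\<^sub>m B) \<subseteq> resolvent_set (B \<circ>\<^sub>m A)"
proof
  fix l assume l: "l \<in> resolvent_set (A \<circ>\<^sub>m B)"
  obtain m where m: "m \<in> resolvent_set (B \<circ>\<^sub>m A)"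
    using nonempty by blast
  have BA: "linear_operator (B \<circ>\<^sub>m A)"
    using A B by (rule linear_operator_comp[rotated])
  have AB_ex: "\<exists>w v. B w = Some v \<and> A v = Some (l *\<^sub>C w - y)" for y
    using resolvent_set_ex1[OF l, of y] by (auto simp: map_comp_Some_iff)
  have AB_inj: "w = 0" if "B w = Some v" "A v = Some (l *\<^sub>C w)" for w v
  proof -
    have "(A \<circ>\<^sub>m B) w = Some (l *\<^sub>C w - 0)" "(A \<circ>\<^sub>m B) 0 = Some (l *\<^sub>C 0 - 0)"
      using that A B by (simp_all add: map_comp_Some_iff linear_operator_zero)
    then show ?thesis
      using resolvent_set_ex1[OF l] by blast
  qed
  \<comment> \<open>For \<open>l = 0\<close> surjectivity of the product passes to its outer factor
    \<open>A\<close>, so the kernel hypothesis makes \<open>A\<close> injective.\<close>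
  have A_inj: "x = 0" if "l = 0" "A x = Some 0" for x
  proof -
    have "\<exists>x. A x = Some y" for y
      using AB_ex[of "- y"] \<open>l = 0\<close> by auto
    then show ?thesis
      using kernel_adjoint_subset_zero[OF dense] kernel that by (force simp: operator_kernel_def)
  qed
  show "l \<in> resolvent_set (B \<circ>\<^sub>m A)"
  proof (rule resolvent_setI[OF BA m])
    fix x assume "(B \<circ>\<^sub>m A) x = Some (l *\<^sub>C x)"
    then obtain u where u: "A x = Some u" "B u = Some (l *\<^sub>C x)"
      by (auto simp: map_comp_Some_iff)
    \<comment> \<open>\<open>u = A x\<close> solves \<open>A (B u) = l u\<close>, so the injectivity
      for the other product applies.\<close>
    then have "u = 0"
      using AB_inj linear_operator_scaleC[OF A u(1)] by blast
    then have "l *\<^sub>C x = 0" "A x = Some 0"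
      using u linear_operator_zero[OF B] by auto
    then show "x = 0"
      using A_inj by auto
  next
    have solve_dom: "\<exists>x. (B \<circ>\<^sub>m A) x = Some (l *\<^sub>C x - y)" if y: "A y = Some a" for y a
    proof -
      \<comment> \<open>\<open>w\<close> is the resolvent of the product applied to
        \<open>A y\<close>, and \<open>v = B w\<close>. Adding \<open>y\<close> to \<open>v\<close>
        cancels \<open>a\<close>.\<close>
      obtain w v where w: "B w = Some v" "A v = Some (l *\<^sub>C w - a)"
        using AB_ex by blast
      have Avy: "A (v + y) = Some (l *\<^sub>C w)"
        using linear_operator_add[OF A w(2) y] by simp
      show ?thesis
      proof (cases "l = 0")
        case True
        then have "v = - y"
          using A_inj Avy by (auto simp: eq_neg_iff_add_eq_0)
        \<comment> \<open>Now \<open>B w = - y\<close>, so only a preimage of \<open>w\<close> under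
          \<open>A\<close> is missing; surjectivity at \<open>l = 0\<close> gives
          \<open>s\<close>.\<close>
        obtain t s where "B t = Some s" "A s = Some w"
          using AB_ex[of "- w"] True by auto
        then have "(B \<circ>\<^sub>m A) s = Some (- y)"
          using w \<open>v = - y\<close> by (simp add: map_comp_Some_iff)
        then show ?thesis
          using True by auto
      next
        case False
        then have "A (inverse l *\<^sub>C (v + y)) = Some w"
          using linear_operator_scaleC[OF A Avy, of "inverse l"] by (simp add: scaleC_scaleC)
        then have "(B \<circ>\<^sub>m A) (inverse l *\<^sub>C (v + y)) = Some v"
          using w by (simp add: map_comp_Some_iff)
        then show ?thesis
          using False by (intro exI[of _ "inverse l *\<^sub>C (v + y)"]) (simp add: scaleC_scaleC)
      qed
    qed
    show "\<exists>x. (B \<circ>\<^sub>m A) x = Some (l *\<^sub>C x - y)" for y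
    proof -
      \<comment> \<open>\<open>z\<close> is the resolvent at \<open>m\<close> applied to
        \<open>y\<close>, hence lies in the domain of \<open>A\<close>. It misses the equation at
        \<open>l\<close> by \<open>(l - m) z\<close>, which the multiple \<open>(m - l) w\<close> of
        the solution with right-hand side \<open>z\<close> corrects.\<close>
      obtain z where z: "(B \<circ>\<^sub>m A) z = Some (m *\<^sub>C z - y)"
        using resolvent_set_ex1[OF m, of y] by auto
      then obtain a where "A z = Some a"
        by (auto simp: map_comp_Some_iff)
      then obtain w where w: "(B \<circ>\<^sub>m A) w = Some (l *\<^sub>C w - z)"
        using solve_dom by blast
      have "(B \<circ>\<^sub>m A) (z + (m - l) *\<^sub>C w) = Some (m *\<^sub>C z - y + (m - l) *\<^sub>C (l *\<^sub>C w - z))"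
        using linear_operator_add[OF BA z linear_operator_scaleC[OF BA w]] .
      also have "m *\<^sub>C z - y + (m - l) *\<^sub>C (l *\<^sub>C w - z) = l *\<^sub>C (z + (m - l) *\<^sub>C w) - y"
        by (simp add: scaleC_add_right scaleC.scale_right_diff_distrib
            scaleC.scale_left_diff_distrib right_diff_distrib scaleC_scaleC mult.commute)
      finally show ?thesis by blast
    qed
  qed
qed

theorem theorem4p4:
  fixes A B :: "'a::complex_hilbert \<rightharpoonup> 'a"
  assumes "densely_defined A" and "closable_operator A"
    and "densely_defined B" and "closable_operator B"
    and "spectrum (A \<circ>\<^sub>m B) \<noteq> UNIV"
    and "spectrum (B \<circ>\<^sub>m A) \<noteq> UNIV"
    and "operator_kernel (adjoint_operator A) = operator_kernel A"
    and "operator_kernel B = operator_kernel (adjoint_operator B)"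
  shows "spectrum (B \<circ>\<^sub>m A) = spectrum (A \<circ>\<^sub>m B)"
proof -
  have "linear_operator A" "linear_operator B"
    using assms by (simp_all add: closable_operator_def)
  moreover have "resolvent_set (A \<circ>\<^sub>m B) \<noteq> {}" "resolvent_set (B \<circ>\<^sub>m A) \<noteq> {}"
    using assms by (auto simp: spectrum_def)
  ultimately have "resolvent_set (B \<circ>\<^sub>m A) = resolvent_set (A \<circ>\<^sub>m B)"
    using assms by (intro equalityI resolvent_set_comp_subset) simp_all
  then show ?thesis
    by (simp add: spectrum_def)
qed

end
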